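(* There exists an infinite class of minimal temporal graphs on $n$ vertices with $\Theta(n\cdot\log n)$ edges and $\Theta(n\cdot\log n)$ labels, such that different edges have different labels.
   Context: A temporal graph is a triple $G(L)=(V,E,L)$ where $(V,E)$ is a graph and $L=\{L_e\subseteq\mathbb{N}^*:e\in E\}$ assigns to each edge a set of positive integer labels; the number of labels is $\sum_{e\in E}|L_e|$. A $(u,v)$-journey is a sequence $(u,u_1,l_1),(u_1,u_2,l_2),\ldots,(u_{k-1},v,l_k)$ in which each consecutive pair of vertices forms an edge $e$ with the corresponding label in $L_e$, and $l_1<l_2<\cdots<l_k$. $G(L)$ satisfies TC (is temporally connected) if for every ordered pair of distinct vertices $u,v$ there is a $(u,v)$-journey. A temporal graph $G(L)$ over a connected graph is minimal if it satisfies TC and the removal of any single label from any $L_e$, $e\in E$, results in a temporal graph that does not satisfy TC. "Different edges have different labels" means that no label is assigned to two different edges. *)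

theory Defs
  imports Complex_Main "HOL-Library.Landau_Symbols"
begin

text \<open>Finite simple undirected graphs, an edge being the two-element set of its end points.
  \<open>labels G e\<close> is only meaningful for \<open>e \<in> edges G\<close>.\<close>

record 'v temporal_graph =
  verts :: "'v set"
  edges :: "'v set set"
  labels :: "'v set \<Rightarrow> nat set"

text \<open>The label sets are required to be finite because \<open>card\<close> of an infinite set is 0, which
  would make the number of labels meaningless. This excludes no minimal temporal graph: finitely
  many journeys, hence finitely many labels, suffice for temporal connectivity of a finite graph.\<close>

definition temporal_graph :: "'v temporal_graph \<Rightarrow> bool" where
  "temporal_graph G \<longleftrightarrow>
     finite (verts G) \<and> verts G \<noteq> {} \<and>
     (\<forall>e \<in> edges G. e \<subseteq> verts G \<and> card e = 2) \<and>
     (\<forall>e \<in> edges G. finite (labels G e) \<and> (\<forall>l \<in> labels G e. 0 < l))"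

definition num_vertices :: "'v temporal_graph \<Rightarrow> nat" where
  "num_vertices G = card (verts G)"

definition num_edges :: "'v temporal_graph \<Rightarrow> nat" where
  "num_edges G = card (edges G)"

definition num_labels :: "'v temporal_graph \<Rightarrow> nat" where
  "num_labels G = (\<Sum>e \<in> edges G. card (labels G e))"

definition connected_graph :: "'v temporal_graph \<Rightarrow> bool" where
  "connected_graph G \<longleftrightarrow>
     (\<forall>u \<in> verts G. \<forall>v \<in> verts G. (u, v) \<in> {(x, y). {x, y} \<in> edges G}\<^sup>*)"

fun time_edge_walk ::
  "'v temporal_graph \<Rightarrow> 'v \<Rightarrow> ('v \<times> 'v \<times> nat) list \<Rightarrow> 'v \<Rightarrow> bool" where
  "time_edge_walk G u [] v \<longleftrightarrow> u = v"
| "time_edge_walk G u ((x, y, l) # js) v \<longleftrightarrow>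
     x = u \<and> {x, y} \<in> edges G \<and> l \<in> labels G {x, y} \<and> time_edge_walk G y js v"

definition journey ::
  "'v temporal_graph \<Rightarrow> 'v \<Rightarrow> ('v \<times> 'v \<times> nat) list \<Rightarrow> 'v \<Rightarrow> bool" where
  "journey G u js v \<longleftrightarrow>
     js \<noteq> [] \<and> time_edge_walk G u js v \<and> sorted_wrt (<) (map (\<lambda>(x, y, l). l) js)"

definition temporally_connected :: "'v temporal_graph \<Rightarrow> bool" where
  "temporally_connected G \<longleftrightarrow>
     (\<forall>u \<in> verts G. \<forall>v \<in> verts G. u \<noteq> v \<longrightarrow> (\<exists>js. journey G u js v))"

definition remove_label ::
  "'v temporal_graph \<Rightarrow> 'v set \<Rightarrow> nat \<Rightarrow> 'v temporal_graph" where
  "remove_label G e l = G\<lparr>labels := (labels G)(e := labels G e - {l})\<rparr>"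

definition minimal_temporal_graph :: "'v temporal_graph \<Rightarrow> bool" where
  "minimal_temporal_graph G \<longleftrightarrow>
     temporal_graph G \<and> connected_graph G \<and> temporally_connected G \<and>
     (\<forall>e \<in> edges G. \<forall>l \<in> labels G e. \<not> temporally_connected (remove_label G e l))"

definition edges_have_different_labels :: "'v temporal_graph \<Rightarrow> bool" where
  "edges_have_different_labels G \<longleftrightarrow>
     (\<forall>e \<in> edges G. \<forall>e' \<in> edges G. e \<noteq> e' \<longrightarrow> labels G e \<inter> labels G e' = {})"

end

(* The graphs are the hypercubes on the vertices 0, ..., 2^d - 1, every edge carrying one label.
   The labels of the edges in direction i all lie in the i-th block of 2^d consecutive numbers.
   The edges of one direction form a perfect matching, so consecutive edges of a journey have
   strictly increasing directions: a journey never flips a bit twice. Flipping the differing bits in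
   increasing order connects any two vertices, and the only journey between the two ends of an
   edge is that edge itself, so no label can be spared. *)

theory Submission
  imports Defs
begin

section \<open>Bit flips on natural numbers\<close>

lemma bit_flip_bit_nat: "bit (flip_bit i u) j \<longleftrightarrow> (i = j) \<noteq> bit u j" for u :: nat
  by (auto simp: bit_flip_bit_iff)

lemma flip_bit_flip_bit_nat [simp]: "flip_bit i (flip_bit i u) = u" for u :: nat
  by (rule bit_eqI) (auto simp: bit_flip_bit_nat)

lemma flip_bit_nat_neq [simp]: "flip_bit i u \<noteq> u" "u \<noteq> flip_bit i u" for u :: nat
  by (metis bit_flip_bit_nat)+

lemma flip_bit_nat_eq_iff [simp]: "flip_bit i u = flip_bit j u \<longleftrightarrow> i = j" for u :: nat
  by (metis bit_flip_bit_nat)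

lemma less_exp_iff_bit: "u < 2 ^ d \<longleftrightarrow> (\<forall>n\<ge>d. \<not> bit u n)" for u :: nat
proof -
  have "u < 2 ^ d \<longleftrightarrow> take_bit d u = u"
    by (simp add: take_bit_nat_eq_self_iff)
  also have "\<dots> \<longleftrightarrow> (\<forall>n\<ge>d. \<not> bit u n)"
    by (simp add: bit_eq_iff bit_take_bit_iff) (meson not_less)
  finally show ?thesis .
qed

lemma flip_bit_less_exp [simp]: "i < d \<Longrightarrow> flip_bit i u < 2 ^ d \<longleftrightarrow> u < 2 ^ d" for u :: nat
  by (auto simp: less_exp_iff_bit bit_flip_bit_nat)

section \<open>The labelled hypercube\<close>

definition cube_edges :: "nat \<Rightarrow> nat set set" where
  "cube_edges d = {{u, flip_bit i u} | u i. u < 2 ^ d \<and> i < d}"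

text \<open>The comprehension ranges over all ways to write \<open>e\<close> as an edge; for an edge
  these differ only in the end chosen as \<open>u\<close>, so one label results.
  \<open>Min e\<close> is an offset below \<open>2 ^ d\<close> inside block \<open>i\<close>,
  distinct for distinct edges of one direction. \<open>Suc\<close> keeps labels positive.\<close>

definition cube_labels :: "nat \<Rightarrow> nat set \<Rightarrow> nat set" where
  "cube_labels d e = {Suc (i * 2 ^ d + Min e) | u i. u < 2 ^ d \<and> i < d \<and> e = {u, flip_bit i u}}"

definition cube :: "nat \<Rightarrow> nat temporal_graph" where
  "cube d = \<lparr>verts = {..<2 ^ d}, edges = cube_edges d, labels = cube_labels d\<rparr>"

lemma cube_simps [simp]:
  "verts (cube d) = {..<2 ^ d}" "edges (cube d) = cube_edges d" "labels (cube d) = cube_labels d"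
  by (simp_all add: cube_def)

text \<open>The block number of a label; the subtraction undoes the \<open>Suc\<close> in
  \<open>cube_labels\<close>.\<close>

definition direction :: "nat \<Rightarrow> nat \<Rightarrow> nat" where
  "direction d l = (l - 1) div 2 ^ d"

lemma direction_mono: "l \<le> l' \<Longrightarrow> direction d l \<le> direction d l'"
  by (simp add: direction_def div_le_mono)

text \<open>The two ends differ in bit \<open>i\<close> alone, so the edge fixes its direction, but
  its starting point only up to exchanging the ends.\<close>

lemma insert_flip_bit_eq_iff:
  "{u, flip_bit i u} = {v, flip_bit j v} \<longleftrightarrow> i = j \<and> (v = u \<or> v = flip_bit i u)" for u v :: nat
  unfolding doubleton_eq_iff
  by (metis flip_bit_flip_bit_nat flip_bit_nat_eq_iff)

lemma cube_edgesI: "u < 2 ^ d \<Longrightarrow> i < d \<Longrightarrow> {u, flip_bit i u} \<in> cube_edges d"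
  by (auto simp: cube_edges_def)

lemma cube_labels_edge:
  assumes "u < 2 ^ d" "i < d"
  shows "cube_labels d {u, flip_bit i u} = {Suc (i * 2 ^ d + min u (flip_bit i u))}"
  using assms by (fastforce simp: cube_labels_def insert_flip_bit_eq_iff)

lemma direction_label:
  assumes "u < 2 ^ d"
  shows "direction d (Suc (i * 2 ^ d + min u v)) = i"
  using assms by (auto simp: direction_def)

text \<open>Here \<open>m\<close> is the smaller end. Block number and offset are both read off
  \<open>l\<close>, so the label alone recovers the edge.\<close>

lemma cube_edge_labelE:
  assumes "e \<in> cube_edges d" "l \<in> cube_labels d e"
  obtains m where "cube_labels d e = {l}" "e = {m, flip_bit (direction d l) m}"
    "l = Suc (direction d l * 2 ^ d + m)"
proof -
  from assms(1) obtain u i where ui: "u < 2 ^ d" "i < d" "e = {u, flip_bit i u}"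
    by (auto simp: cube_edges_def)
  define m where "m = min u (flip_bit i u)"
  have lab: "cube_labels d e = {Suc (i * 2 ^ d + m)}"
    using ui by (simp add: cube_labels_edge m_def)
  with assms(2) have l: "l = Suc (i * 2 ^ d + m)" by simp
  then have dir: "direction d l = i"
    using ui(1) by (simp add: m_def direction_label)
  show thesis
  proof
    show "cube_labels d e = {l}" using lab l by simp
    show "e = {m, flip_bit (direction d l) m}"
      unfolding dir ui(3) m_def by (auto simp: min_def)
    show "l = Suc (direction d l * 2 ^ d + m)" unfolding dir by (rule l)
  qed
qed

lemma cube_labels_eq_singleton: "e \<in> cube_edges d \<Longrightarrow> l \<in> cube_labels d e \<Longrightarrow> cube_labels d e = {l}"
  by (erule cube_edge_labelE)

lemma cube_edge_label_flip:
  assumes "{x, y} \<in> cube_edges d" "l \<in> cube_labels d {x, y}"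
  shows "y = flip_bit (direction d l) x"
proof -
  from assms obtain m where "{x, y} = {m, flip_bit (direction d l) m}"
    by (rule cube_edge_labelE)
  then show ?thesis by (auto simp: doubleton_eq_iff)
qed

lemma cube_labels_inj:
  assumes "e \<in> cube_edges d" "l \<in> cube_labels d e" "e' \<in> cube_edges d" "l \<in> cube_labels d e'"
  shows "e = e'"
proof -
  from assms(1,2) obtain m where m: "e = {m, flip_bit (direction d l) m}"
    "l = Suc (direction d l * 2 ^ d + m)" by (rule cube_edge_labelE)
  from assms(3,4) obtain m' where m': "e' = {m', flip_bit (direction d l) m'}"
    "l = Suc (direction d l * 2 ^ d + m')" by (rule cube_edge_labelE)
  have "m = m'" using trans[OF m(2)[symmetric] m'(2)] by simp
  then show ?thesis by (simp add: m(1) m'(1))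
qed

lemma card_cube_labels:
  assumes "e \<in> cube_edges d"
  shows "card (cube_labels d e) = 1"
  using assms by (auto simp: cube_edges_def cube_labels_edge)

lemma finite_cube_edges: "finite (cube_edges d)"
  by (rule finite_subset[of _ "Pow {..<2 ^ d}"]) (auto simp: cube_edges_def)

text \<open>Double counting of pairs of an edge and one of its ends: there are two for each edge,
  and they correspond bijectively to pairs of a vertex and a direction.\<close>

lemma card_cube_edges: "2 * card (cube_edges d) = d * 2 ^ d"
proof -
  let ?f = "\<lambda>(u, i). ({u, flip_bit i u}, u)"
  have "card (SIGMA e : cube_edges d. e) = (\<Sum>e\<in>cube_edges d. card e)"
    using finite_cube_edges by (intro card_SigmaI) (auto simp: cube_edges_def)
  also have "\<dots> = (\<Sum>e\<in>cube_edges d. 2)"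
    by (intro sum.cong) (auto simp: cube_edges_def)
  also have "\<dots> = 2 * card (cube_edges d)" by simp
  also have "(SIGMA e : cube_edges d. e) = ?f ` ({..<2 ^ d} \<times> {..<d})"
  proof (intro equalityI subsetI)
    fix p assume "p \<in> (SIGMA e : cube_edges d. e)"
    then obtain u i w where "p = ({u, flip_bit i u}, w)" "w = u \<or> w = flip_bit i u"
      "u < 2 ^ d" "i < d"
      by (auto simp: cube_edges_def)
    \<comment> \<open>As flipping is an involution, the edge can be written with \<open>w\<close> as
      its starting point.\<close>
    then have "p = ?f (w, i)" "(w, i) \<in> {..<2 ^ d} \<times> {..<d}" by auto
    then show "p \<in> ?f ` ({..<2 ^ d} \<times> {..<d})" by blast
  qed (auto simp: cube_edges_def)
  also have "card \<dots> = card ({..<2 ^ d :: nat} \<times> {..<d})"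
    by (rule card_image) (auto simp: inj_on_def insert_flip_bit_eq_iff)
  finally show ?thesis by (simp add: mult.commute)
qed

lemma temporal_graph_cube: "temporal_graph (cube d)"
  by (auto simp: temporal_graph_def cube_edges_def cube_labels_edge lessThan_empty_iff)

section \<open>Temporal connectivity\<close>

text \<open>Connectivity is the case \<open>k = 0\<close>. The general \<open>k\<close> allows
  induction downwards from \<open>d\<close>, and the lower bound on the directions ensures that an
  edge of smaller direction can be put in front.\<close>

lemma cube_walk_up:
  assumes "k \<le> d" "u < 2 ^ d" "v < 2 ^ d" "\<And>j. j < k \<Longrightarrow> bit u j = bit v j"
  shows "\<exists>js. time_edge_walk (cube d) u js v \<and> sorted_wrt (<) (map (\<lambda>(x, y, l). l) js) \<and>
           (\<forall>(x, y, l) \<in> set js. k \<le> direction d l)"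
  using assms
proof (induction k arbitrary: u rule: inc_induct)
  case base
  \<comment> \<open>Bits below \<open>d\<close> agree by assumption, and those from \<open>d\<close>
    on are all zero.\<close>
  then have "u = v"
    by (intro bit_eqI) (metis less_exp_iff_bit not_less)
  then have "time_edge_walk (cube d) u [] v" by simp
  then show ?case by (intro exI[of _ "[]"]) simp
next
  case (step k)
  show ?case
  proof (cases "bit u k = bit v k")
    case True
    with step obtain js where "time_edge_walk (cube d) u js v"
      "sorted_wrt (<) (map (\<lambda>(x, y, l). l) js)" "\<forall>(x, y, l) \<in> set js. Suc k \<le> direction d l"
      by (metis less_Suc_eq)
    then show ?thesis by (intro exI[of _ js]) auto
  next
    case False
    \<comment> \<open>The walk starts by correcting bit \<open>k\<close>; the induction hypothesis
      leads on from \<open>?w\<close>.\<close>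
    let ?w = "flip_bit k u" and ?l = "Suc (k * 2 ^ d + min u (flip_bit k u))"
    have dir: "direction d ?l = k"
      using step.prems by (simp add: direction_label)
    have "?w < 2 ^ d" "\<And>j. j < Suc k \<Longrightarrow> bit ?w j = bit v j"
      using step.prems step.hyps False by (auto simp: bit_flip_bit_nat less_Suc_eq)
    then obtain js where js: "time_edge_walk (cube d) ?w js v"
      "sorted_wrt (<) (map (\<lambda>(x, y, l). l) js)" "\<forall>(x, y, l) \<in> set js. Suc k \<le> direction d l"
      using step.IH step.prems by blast
    have "?l < l" if "(x, y, l) \<in> set js" for x y l
    proof (rule ccontr)
      assume "\<not> ?l < l"
      then have "direction d l \<le> k" using direction_mono[of l ?l d] dir by simp
      with js(3) that show False by fastforce
    qed
    then have "sorted_wrt (<) (map (\<lambda>(x, y, l). l) ((u, ?w, ?l) # js))"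
      using js(2) by auto
    moreover have "time_edge_walk (cube d) u ((u, ?w, ?l) # js) v"
      using js(1) step.prems step.hyps by (simp add: cube_edgesI cube_labels_edge)
    moreover have "\<forall>(x, y, l) \<in> set ((u, ?w, ?l) # js). k \<le> direction d l"
      using js(3) dir by fastforce
    ultimately show ?thesis by blast
  qed
qed

lemma temporally_connected_cube: "temporally_connected (cube d)"
  unfolding temporally_connected_def
proof (intro ballI impI)
  fix u v assume "u \<in> verts (cube d)" "v \<in> verts (cube d)" "u \<noteq> v"
  then obtain js where js: "time_edge_walk (cube d) u js v"
    "sorted_wrt (<) (map (\<lambda>(x, y, l). l) js)"
    using cube_walk_up[of 0 d u v] by auto
  with \<open>u \<noteq> v\<close> have "js \<noteq> []" by auto
  with js show "\<exists>js. journey (cube d) u js v"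
    by (auto simp: journey_def)
qed

lemma time_edge_walk_rtrancl:
  "time_edge_walk G u js v \<Longrightarrow> (u, v) \<in> {(x, y). {x, y} \<in> edges G}\<^sup>*"
  by (induction G u js v rule: time_edge_walk.induct) (auto intro: converse_rtrancl_into_rtrancl)

lemma temporally_connected_imp_connected_graph: "temporally_connected G \<Longrightarrow> connected_graph G"
  unfolding connected_graph_def temporally_connected_def journey_def
  by (metis rtrancl.rtrancl_refl time_edge_walk_rtrancl)

section \<open>Minimality\<close>

lemma time_edge_walk_remove_label:
  "time_edge_walk (remove_label G e l) u js v \<Longrightarrow> time_edge_walk G u js v"
  by (induction js arbitrary: u) (auto simp: remove_label_def split: if_splits)

text \<open>Two successive steps in one direction would use the same edge, hence its only label,
  twice. With strictly rising directions each bit is flipped at most once, so the parity of its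
  flips is mere membership.\<close>

lemma cube_walk_directions:
  assumes "time_edge_walk (cube d) u js v" "sorted_wrt (<) (map (\<lambda>(x, y, l). l) js)"
  shows "sorted_wrt (<) (map (\<lambda>(x, y, l). direction d l) js) \<and>
    (\<forall>n. bit v n \<longleftrightarrow> bit u n \<noteq> (n \<in> (\<lambda>(x, y, l). direction d l) ` set js))"
  using assms
proof (induction js arbitrary: u)
  case Nil
  then show ?case by simp
next
  case (Cons a js)
  obtain y l where a: "a = (u, y, l)" and e: "{u, y} \<in> cube_edges d" "l \<in> cube_labels d {u, y}"
    and walk: "time_edge_walk (cube d) y js v"
    using Cons.prems(1) by (cases a) auto
  have y: "y = flip_bit (direction d l) u"
    using e by (rule cube_edge_label_flip)
  have IH: "sorted_wrt (<) (map (\<lambda>(x, y, l). direction d l) js)"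
    "\<And>n. bit v n \<longleftrightarrow> bit y n \<noteq> (n \<in> (\<lambda>(x, y, l). direction d l) ` set js)"
    using Cons.IH[OF walk] Cons.prems(2) by auto
  \<comment> \<open>It suffices to compare with the next step \<open>b\<close>, since the directions
    rise from there on by \<open>IH(1)\<close>.\<close>
  have less: "direction d l < direction d l'" if "(x', y', l') \<in> set js" for x' y' l'
  proof (cases js)
    case Nil
    with that show ?thesis by simp
  next
    case (Cons b bs)
    obtain z m where b: "b = (y, z, m)" and e': "{y, z} \<in> cube_edges d" "m \<in> cube_labels d {y, z}"
      using walk Cons by (cases b) auto
    have "l < m" using Cons.prems(2) a b Cons by simp
    have z: "z = flip_bit (direction d m) y"
      using e' by (rule cube_edge_label_flip)
    have "direction d l \<noteq> direction d m"
    proof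
      assume "direction d l = direction d m"
      \<comment> \<open>The second flip leads back to \<open>u\<close>.\<close>
      with y z have "{y, z} = {u, y}" by auto
      with e e' \<open>l < m\<close> show False
        by (metis cube_labels_eq_singleton insert_commute less_irrefl singletonD)
    qed
    with \<open>l < m\<close> have "direction d l < direction d m"
      by (simp add: direction_mono le_neq_implies_less)
    moreover have "direction d m \<le> direction d l'"
      using that IH(1) Cons b by auto
    ultimately show ?thesis by simp
  qed
  have "sorted_wrt (<) (map (\<lambda>(x, y, l). direction d l) (a # js))"
    using IH(1) less a by auto
  moreover have "direction d l \<notin> (\<lambda>(x, y, l). direction d l) ` set js"
    using less by fastforce
  \<comment> \<open>Since this direction does not recur in \<open>js\<close>, exclusive or with it
    amounts to inserting it into the set.\<close>
  then have "bit v n \<longleftrightarrow> bit u n \<noteq> (n \<in> (\<lambda>(x, y, l). direction d l) ` set (a # js))" for n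
    unfolding a y IH(2)[unfolded y] bit_flip_bit_nat list.set image_insert prod.case by blast
  ultimately show ?case by blast
qed

text \<open>The ends of \<open>e\<close> differ only in bit \<open>i\<close>, so a journey between
  them has \<open>i\<close> as its only direction, exactly once. It is the single step along
  \<open>e\<close>, which has no label left.\<close>

lemma cube_remove_label_not_connected:
  assumes "e \<in> cube_edges d" "l \<in> cube_labels d e"
  shows "\<not> temporally_connected (remove_label (cube d) e l)"
proof
  let ?H = "remove_label (cube d) e l"
  assume conn: "temporally_connected ?H"
  from assms obtain u i where u: "u < 2 ^ d" "i < d" "e = {u, flip_bit i u}"
    by (auto simp: cube_edges_def)
  let ?v = "flip_bit i u"
  have "u \<in> verts ?H" "?v \<in> verts ?H"
    using u by (auto simp: remove_label_def)
  with conn obtain js where js: "journey ?H u js ?v"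
    unfolding temporally_connected_def by (metis flip_bit_nat_neq(2))
  define ds where "ds = map (\<lambda>(x, y, l). direction d l) js"
  have "time_edge_walk (cube d) u js ?v"
    using js by (auto simp: journey_def intro: time_edge_walk_remove_label)
  from cube_walk_directions[OF this] js have "sorted_wrt (<) ds"
    and bits: "\<And>n. bit ?v n \<longleftrightarrow> bit u n \<noteq> (n \<in> set ds)"
    by (auto simp: journey_def ds_def)
  then have "distinct ds" by (simp add: strict_sorted_iff)
  moreover have "n \<in> set ds \<longleftrightarrow> n = i" for n
    using bits[of n] by (auto simp: bit_flip_bit_nat)
  then have "set ds = {i}" by blast
  ultimately have "length js = 1"
    using distinct_card[of ds] by (simp add: ds_def)
  then obtain m where "js = [(u, ?v, m)]" "m \<in> labels ?H e"
    using js u(3) by (auto simp: journey_def length_Suc_conv)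
  moreover have "labels ?H e = {}"
    using cube_labels_eq_singleton[OF assms] by (simp add: remove_label_def)
  ultimately show False by simp
qed

lemma minimal_temporal_graph_cube: "minimal_temporal_graph (cube d)"
  by (simp add: minimal_temporal_graph_def temporal_graph_cube temporally_connected_cube
      temporally_connected_imp_connected_graph cube_remove_label_not_connected)

lemma edges_have_different_labels_cube: "edges_have_different_labels (cube d)"
  by (auto simp: edges_have_different_labels_def dest: cube_labels_inj)

section \<open>Order of growth\<close>

lemma num_vertices_cube: "num_vertices (cube d) = 2 ^ d"
  by (simp add: num_vertices_def)

lemma num_labels_cube: "num_labels (cube d) = num_edges (cube d)"
  by (simp add: num_labels_def num_edges_def card_cube_labels)

text \<open>With \<open>n = 2 ^ d\<close> vertices, \<open>ln n = d * ln 2\<close>, so the two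
  functions agree exactly up to the factor \<open>1 / (2 * ln 2)\<close>.\<close>

lemma num_edges_cube_bigtheta:
  "(\<lambda>d. real (num_edges (cube d)))
     \<in> \<Theta>(\<lambda>d. real (num_vertices (cube d)) * ln (real (num_vertices (cube d))))"
proof -
  have "real (num_edges (cube d)) =
      1 / (2 * ln 2) * (real (num_vertices (cube d)) * ln (real (num_vertices (cube d))))" for d
    using arg_cong[OF card_cube_edges[of d], of real]
    by (simp add: num_edges_def num_vertices_cube ln_realpow mult.commute)
  then show ?thesis by simp
qed

theorem theorem3:
  "\<exists>G :: nat \<Rightarrow> nat temporal_graph.
     strict_mono (\<lambda>k. num_vertices (G k)) \<and>
     (\<forall>k. minimal_temporal_graph (G k) \<and> edges_have_different_labels (G k)) \<and>
     (\<lambda>k. real (num_edges (G k)))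
       \<in> \<Theta>(\<lambda>k. real (num_vertices (G k)) * ln (real (num_vertices (G k)))) \<and>
     (\<lambda>k. real (num_labels (G k)))
       \<in> \<Theta>(\<lambda>k. real (num_vertices (G k)) * ln (real (num_vertices (G k))))"
proof (intro exI[of _ cube] conjI allI)
  show "strict_mono (\<lambda>k. num_vertices (cube k))"
    by (simp add: num_vertices_cube strict_mono_def)
  show "(\<lambda>k. real (num_labels (cube k)))
      \<in> \<Theta>(\<lambda>k. real (num_vertices (cube k)) * ln (real (num_vertices (cube k))))"
    unfolding num_labels_cube by (rule num_edges_cube_bigtheta)
qed (fact minimal_temporal_graph_cube edges_have_different_labels_cube num_edges_cube_bigtheta)+

end
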